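(* Let $m\geq 3$ be an odd integer and let $r\geq 2$ be an even integer. Then $3\leq\chi_{la}(rK_{m,m})\leq 6$.
   Context: All graphs are simple and finite. Let $G=(V,E)$ be a graph without isolated vertices. For a bijection $f:E\to\{1,2,\dots,|E|\}$ and a vertex $u$, the weight of $u$ is $w(u)=\sum_{e\in E(u)}f(e)$, where $E(u)$ is the set of edges incident to $u$. The bijection $f$ is a local antimagic labeling of $G$ if $w(u)\neq w(v)$ for every edge $uv\in E$; it then induces a proper vertex coloring of $G$ in which $v$ gets color $w(v)$. The local antimagic chromatic number $\chi_{la}(G)$ is the minimum number of distinct colors (distinct values of $w$) over all local antimagic labelings of $G$. $K_{m,m}$ is the complete bipartite graph with both parts of size $m$, and $rK_{m,m}$ is the disjoint union of $r$ copies of $K_{m,m}$ (the labels $1,\dots,rm^2$ being used across the whole graph). *)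

theory Defs
  imports Main "HOL-Library.Extended_Nat"
begin

(* A graph is a pair of its vertex set and its edge set; an edge is the set of its two ends. *)
type_synonym 'a graph = "'a set \<times> 'a set set"

abbreviation verts :: "'a graph \<Rightarrow> 'a set" where
  "verts \<equiv> fst"

abbreviation edges :: "'a graph \<Rightarrow> 'a set set" where
  "edges \<equiv> snd"

definition simple_graph :: "'a graph \<Rightarrow> bool" where
  "simple_graph G \<longleftrightarrow> finite (verts G) \<and> (\<forall>e\<in>edges G. e \<subseteq> verts G \<and> card e = 2)"

definition incident_edges :: "'a graph \<Rightarrow> 'a \<Rightarrow> 'a set set" where
  "incident_edges G u = {e \<in> edges G. u \<in> e}"

definition no_isolated_vertices :: "'a graph \<Rightarrow> bool" where
  "no_isolated_vertices G \<longleftrightarrow> (\<forall>u\<in>verts G. incident_edges G u \<noteq> {})"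

definition weight :: "'a graph \<Rightarrow> ('a set \<Rightarrow> nat) \<Rightarrow> 'a \<Rightarrow> nat" where
  "weight G f u = (\<Sum>e\<in>incident_edges G u. f e)"

definition local_antimagic_labeling :: "'a graph \<Rightarrow> ('a set \<Rightarrow> nat) \<Rightarrow> bool" where
  "local_antimagic_labeling G f \<longleftrightarrow>
     bij_betw f (edges G) {1..card (edges G)} \<and>
     (\<forall>u v. {u, v} \<in> edges G \<longrightarrow> weight G f u \<noteq> weight G f v)"

(* The infimum is taken in enat, so it is an attained minimum if G has a local antimagic
   labeling, and infinity otherwise. In particular, a finite upper bound includes the existence
   of a labeling. *)
definition chi_la :: "'a graph \<Rightarrow> enat" where
  "chi_la G = (INF f\<in>{f. local_antimagic_labeling G f}. enat (card (weight G f ` verts G)))"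

definition complete_bipartite :: "nat \<Rightarrow> nat \<Rightarrow> (nat + nat) graph" where
  "complete_bipartite m n =
     (Inl ` {..<m} \<union> Inr ` {..<n}, {{Inl i, Inr j} |i j. i < m \<and> j < n})"

(* The disjoint union of r copies of G; the first component of a vertex is the index of its copy. *)
definition copies :: "nat \<Rightarrow> 'a graph \<Rightarrow> (nat \<times> 'a) graph" where
  "copies r G = ({..<r} \<times> verts G, {Pair k ` e |k e. k < r \<and> e \<in> edges G})"

lemma simple_graph_complete_bipartite: "simple_graph (complete_bipartite m n)"
  by (auto simp: simple_graph_def complete_bipartite_def)

lemma simple_graph_copies:
  assumes "simple_graph G"
  shows "simple_graph (copies r G)"
  unfolding simple_graph_def
proof (intro conjI ballI)
  show "finite (verts (copies r G))"
    using assms by (simp add: simple_graph_def copies_def)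
next
  fix e assume "e \<in> edges (copies r G)"
  then obtain k e' where e: "e = Pair k ` e'" and "k < r" and "e' \<in> edges G"
    by (auto simp: copies_def)
  then have e': "e' \<subseteq> verts G" "card e' = 2"
    using assms by (auto simp: simple_graph_def)
  show "e \<subseteq> verts (copies r G)"
    using e' \<open>k < r\<close> by (auto simp: e copies_def)
  show "card e = 2"
    using e' by (simp add: e card_image inj_on_def)
qed

lemma no_isolated_vertices_complete_bipartite:
  assumes "m > 0" and "n > 0"
  shows "no_isolated_vertices (complete_bipartite m n)"
proof -
  have edge: "{Inl i, Inr j} \<in> edges (complete_bipartite m n)" if "i < m" "j < n" for i j
    unfolding complete_bipartite_def using that by force
  have "\<exists>e\<in>edges (complete_bipartite m n). u \<in> e"
    if "u \<in> verts (complete_bipartite m n)" for u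
  proof (cases u)
    case (Inl i)
    then have "i < m"
      using that by (auto simp: complete_bipartite_def)
    from edge[OF this \<open>n > 0\<close>] show ?thesis
      unfolding Inl by (rule bexI[rotated]) simp
  next
    case (Inr j)
    then have "j < n"
      using that by (auto simp: complete_bipartite_def)
    from edge[OF \<open>m > 0\<close> this] show ?thesis
      unfolding Inr by (rule bexI[rotated]) simp
  qed
  then show ?thesis
    unfolding no_isolated_vertices_def incident_edges_def by blast
qed

lemma no_isolated_vertices_copies:
  assumes "no_isolated_vertices G"
  shows "no_isolated_vertices (copies r G)"
proof -
  have "\<exists>e\<in>edges (copies r G). u \<in> e" if "u \<in> verts (copies r G)" for u
  proof -
    from that obtain k v where u: "u = (k, v)" and k: "k < r" and v: "v \<in> verts G"
      by (auto simp: copies_def)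
    from assms v obtain e where e: "e \<in> edges G" "v \<in> e"
      by (auto simp: no_isolated_vertices_def incident_edges_def)
    have "Pair k ` e \<in> edges (copies r G)"
      unfolding copies_def snd_conv using k e(1) by blast
    moreover have "u \<in> Pair k ` e"
      unfolding u using e(2) by (rule imageI)
    ultimately show ?thesis by blast
  qed
  then show ?thesis
    unfolding no_isolated_vertices_def incident_edges_def by blast
qed

lemma chi_la_attained:
  assumes "local_antimagic_labeling G g"
  shows "\<exists>f. local_antimagic_labeling G f \<and> chi_la G = enat (card (weight G f ` verts G))"
proof -
  let ?c = "\<lambda>f. enat (card (weight G f ` verts G))"
  let ?L = "{f. local_antimagic_labeling G f}"
  have "?c g \<in> ?c ` ?L"
    using assms by (intro imageI CollectI)
  then have "Inf (?c ` ?L) \<in> ?c ` ?L"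
    by (rule wellorder_InfI)
  then obtain f where "f \<in> ?L" "Inf (?c ` ?L) = ?c f"
    by (rule imageE)
  then show ?thesis
    unfolding chi_la_def by blast
qed

end

theory Submission
  imports Defs "HOL-Number_Theory.Cong"
begin

text \<open>
  A labeling of \<open>r K\<^sub>m\<^sub>,\<^sub>m\<close> is a sequence of \<open>r\<close> square matrices of order \<open>m\<close> containing
  \<open>1, \<dots>, r m\<^sup>2\<close> once each, and the colors are the row and column sums. With two colors, a copy would
  have equal row sums and equal column sums, and counting the total twice would identify the two.

  For the upper bound write \<open>r = 2s\<close> and \<open>m = 2h + 1\<close>. Up to \<open>1\<close>, the entry is
  \<open>2 (s S + u) + b\<close>, where \<open>S\<close> is a magic square. At each cell, \<open>u\<close> depends on the copy through a
  permutation of \<open>{..<s}\<close>; these are chosen so that all lines of a copy have the same \<open>u\<close>-sum,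
  which takes at most two consecutive values over all copies. The bit \<open>b\<close> is given by a \<open>0\<close>-\<open>1\<close> matrix for half of the copies and by its
  complement for the others. This matrix has all row sums \<open>h\<close> and all column sums in
  \<open>{h - 1, h + 1, h + 2}\<close>. Hence rows and columns of a copy never agree, the bit sums are in the
  interval \<open>{h - 1..h + 2}\<close>, which is invariant under complementation, and adding the two
  possible contributions of \<open>u\<close>, which differ by \<open>2\<close>, gives six consecutive numbers.
\<close>

section \<open>Labelings as sequences of matrices\<close>

definition cell_edge :: "nat \<times> nat \<times> nat \<Rightarrow> (nat \<times> (nat + nat)) set" where
  "cell_edge = (\<lambda>(k, i, j). {(k, Inl i), (k, Inr j)})"

lemma cell_edge_eq_iff [simp]: "cell_edge c = cell_edge c' \<longleftrightarrow> c = c'"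
  by (cases c; cases c') (auto simp: cell_edge_def doubleton_eq_iff)

lemma edges_copies_complete_bipartite:
  "edges (copies r (complete_bipartite m n)) = cell_edge ` ({..<r} \<times> {..<m} \<times> {..<n})"
  (is "?E = ?C")
proof (intro equalityI subsetI)
  fix e assume "e \<in> ?E"
  then obtain k i j where "k < r" "i < m" "j < n" "e = Pair k ` {Inl i, Inr j}"
    unfolding copies_def complete_bipartite_def snd_conv by blast
  then have "(k, i, j) \<in> {..<r} \<times> {..<m} \<times> {..<n}" "e = cell_edge (k, i, j)"
    by (simp_all add: cell_edge_def)
  then show "e \<in> ?C" by blast
next
  fix e assume "e \<in> ?C"
  then obtain k i j where "k < r" "i < m" "j < n" "e = cell_edge (k, i, j)"
    by blast
  then have "e = Pair k ` {Inl i, Inr j}"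
    by (simp add: cell_edge_def)
  with \<open>k < r\<close> \<open>i < m\<close> \<open>j < n\<close> show "e \<in> ?E"
    unfolding copies_def complete_bipartite_def snd_conv by blast
qed

lemma card_edges_copies_complete_bipartite:
  "card (edges (copies r (complete_bipartite m n))) = r * (m * n)"
  by (simp add: edges_copies_complete_bipartite card_image inj_on_def)

lemma verts_copies_complete_bipartite:
  "verts (copies r (complete_bipartite m n)) = {..<r} \<times> (Inl ` {..<m} \<union> Inr ` {..<n})"
  by (simp add: copies_def complete_bipartite_def)

lemma weight_Inl:
  assumes "k < r" "i < m"
  shows "weight (copies r (complete_bipartite m n)) f (k, Inl i)
    = (\<Sum>j<n. f (cell_edge (k, i, j)))"
proof -
  have "incident_edges (copies r (complete_bipartite m n)) (k, Inl i)
      = (\<lambda>j. cell_edge (k, i, j)) ` {..<n}"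
    using assms unfolding incident_edges_def edges_copies_complete_bipartite
    by (auto simp: cell_edge_def)
  then show ?thesis
    by (simp add: weight_def sum.reindex inj_on_def)
qed

lemma weight_Inr:
  assumes "k < r" "j < n"
  shows "weight (copies r (complete_bipartite m n)) f (k, Inr j)
    = (\<Sum>i<m. f (cell_edge (k, i, j)))"
proof -
  have "incident_edges (copies r (complete_bipartite m n)) (k, Inr j)
      = (\<lambda>i. cell_edge (k, i, j)) ` {..<m}"
    using assms unfolding incident_edges_def edges_copies_complete_bipartite
    by (auto simp: cell_edge_def)
  then show ?thesis
    by (simp add: weight_def sum.reindex inj_on_def)
qed

lemma chi_la_copies_ge_3:
  assumes "m > 0" "r > 0"
  shows "3 \<le> chi_la (copies r (complete_bipartite m m))"
  unfolding chi_la_def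
proof (rule INF_greatest)
  let ?G = "copies r (complete_bipartite m m)"
  fix f assume "f \<in> {f. local_antimagic_labeling ?G f}"
  then have neq: "{u, v} \<in> edges ?G \<Longrightarrow> weight ?G f u \<noteq> weight ?G f v" for u v
    unfolding local_antimagic_labeling_def by blast
  let ?x = "\<lambda>i. weight ?G f (0, Inl i)" and ?y = "\<lambda>j. weight ?G f (0, Inr j)"
  let ?W = "weight ?G f ` verts ?G"
  have xy: "?x i \<noteq> ?y j" if "i < m" "j < m" for i j
    by (rule neq) (use that assms in \<open>force simp: edges_copies_complete_bipartite cell_edge_def\<close>)
  have x: "?x i \<in> ?W" and y: "?y i \<in> ?W" if "i < m" for i
    using that assms by (auto simp: verts_copies_complete_bipartite)
  have fin: "finite ?W"
    by (simp add: verts_copies_complete_bipartite)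
  \<comment> \<open>Both sides are the sum of all labels in copy \<open>0\<close>.\<close>
  have "(\<Sum>i<m. ?x i) = (\<Sum>j<m. ?y j)"
    using assms by (simp add: weight_Inl weight_Inr) (rule sum.swap)
  have "\<not> card ?W \<le> 2"
  proof
    assume "card ?W \<le> 2"
    then have "card ?W \<le> card {?x 0, ?y 0}"
      using xy[of 0 0] assms by simp
    \<comment> \<open>The adjacent vertices behind \<open>?x 0\<close> and \<open>?y 0\<close>
      already use two colors. Every \<open>?x i\<close> differs from \<open>?y 0\<close>, so it must
      be \<open>?x 0\<close>; likewise every \<open>?y j\<close> is \<open>?y 0\<close>.\<close>
    then have W: "{?x 0, ?y 0} = ?W"
      by (intro card_seteq fin) (use x y assms in auto)
    have other: "b = c" if "b \<in> {a, c}" "a \<noteq> b" for a b c :: nat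
      using that by simp
    have "(\<Sum>i<m. ?x i) = (\<Sum>i<m. ?x 0)"
    proof (rule sum.cong)
      fix i assume "i \<in> {..<m}"
      then have "i < m" by simp
      then show "?x i = ?x 0"
        using x[folded W, unfolded insert_commute[of "?x 0"]] xy[OF _ assms(1), symmetric]
        by (intro other)
    qed simp
    moreover have "(\<Sum>j<m. ?y j) = (\<Sum>j<m. ?y 0)"
    proof (rule sum.cong)
      fix j assume "j \<in> {..<m}"
      then have "j < m" by simp
      then show "?y j = ?y 0"
        using y[folded W] xy[OF assms(1)] by (intro other)
    qed simp
    ultimately have "m * ?x 0 = m * ?y 0"
      using \<open>(\<Sum>i<m. ?x i) = (\<Sum>j<m. ?y j)\<close> by auto
    then show False
      using xy[of 0 0] assms by simp
  qed
  then have "3 \<le> card ?W" by simp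
  then show "3 \<le> enat (card ?W)"
    by (simp add: numeral_eq_enat)
qed

lemma chi_la_copies_le:
  fixes L :: "nat \<times> nat \<times> nat \<Rightarrow> nat"
  assumes bij: "bij_betw L ({..<r} \<times> {..<m} \<times> {..<n}) {1..r * (m * n)}"
    and neq: "\<And>k i j. k < r \<Longrightarrow> i < m \<Longrightarrow> j < n \<Longrightarrow>
      (\<Sum>j'<n. L (k, i, j')) \<noteq> (\<Sum>i'<m. L (k, i', j))"
    and fin: "finite C"
    and row: "\<And>k i. k < r \<Longrightarrow> i < m \<Longrightarrow> (\<Sum>j<n. L (k, i, j)) \<in> C"
    and col: "\<And>k j. k < r \<Longrightarrow> j < n \<Longrightarrow> (\<Sum>i<m. L (k, i, j)) \<in> C"
  shows "chi_la (copies r (complete_bipartite m n)) \<le> enat (card C)"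
proof -
  let ?G = "copies r (complete_bipartite m n)"
  \<comment> \<open>As \<open>cell_edge\<close> is injective on all triples, \<open>inv\<close>
    recovers the cell from its edge.\<close>
  define f where "f = L \<circ> inv cell_edge"
  have "inj cell_edge"
    by (simp add: inj_def)
  then have f: "f (cell_edge c) = L c" for c
    by (simp add: f_def)
  have "bij_betw (f \<circ> cell_edge) ({..<r} \<times> {..<m} \<times> {..<n}) {1..r * (m * n)}"
    using bij by (simp add: f cong: bij_betw_cong)
  then have "bij_betw f (edges ?G) {1..r * (m * n)}"
    unfolding edges_copies_complete_bipartite
    by (subst bij_betw_comp_iff[of cell_edge "{..<r} \<times> {..<m} \<times> {..<n}"])
       (auto simp: bij_betw_def inj_on_def)
  moreover have "weight ?G f u \<noteq> weight ?G f v" if "{u, v} \<in> edges ?G" for u v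
  proof -
    from that obtain k i j where "k < r" "i < m" "j < n" "{u, v} = {(k, Inl i), (k, Inr j)}"
      by (auto simp: edges_copies_complete_bipartite cell_edge_def)
    with neq[of k i j] show ?thesis
      by (auto simp: doubleton_eq_iff weight_Inl weight_Inr f)
  qed
  ultimately have "local_antimagic_labeling ?G f"
    by (auto simp: local_antimagic_labeling_def card_edges_copies_complete_bipartite)
  then have "chi_la ?G \<le> enat (card (weight ?G f ` verts ?G))"
    unfolding chi_la_def by (intro INF_lower) simp
  also have "weight ?G f ` verts ?G \<subseteq> C"
    using row col by (auto simp: verts_copies_complete_bipartite weight_Inl weight_Inr f)
  then have "enat (card (weight ?G f ` verts ?G)) \<le> enat (card C)"
    by (simp add: card_mono fin)
  finally show ?thesis .
qed

section \<open>The magic square\<close>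

text \<open>Since \<open>c\<close> is a unit modulo \<open>m\<close>, the map taking
  \<open>j\<close> to \<open>x + c * j\<close> permutes the residues.\<close>

lemma sum_affine_mod:
  fixes g :: "nat \<Rightarrow> 'a :: comm_monoid_add"
  assumes "coprime c m" "m > 0"
  shows "(\<Sum>j<m. g ((x + c * j) mod m)) = (\<Sum>a<m. g a)"
proof -
  have inj: "inj_on (\<lambda>j. (x + c * j) mod m) {..<m}"
  proof (rule inj_onI)
    fix j j' assume "j \<in> {..<m}" "j' \<in> {..<m}" "(x + c * j) mod m = (x + c * j') mod m"
    then have "[j = j'] (mod m)"
      using assms by (metis cong_def cong_add_lcancel_nat cong_mult_lcancel_nat)
    then show "j = j'"
      using \<open>j \<in> {..<m}\<close> \<open>j' \<in> {..<m}\<close> by (simp add: cong_def)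
  qed
  have "(\<lambda>j. (x + c * j) mod m) ` {..<m} = {..<m}"
    by (rule endo_inj_surj) (use inj assms in auto)
  then show ?thesis
    using sum.reindex[OF inj, of g] by (simp add: o_def)
qed

text \<open>For odd \<open>m\<close>, the two base-\<open>m\<close> digits form a pair of orthogonal
  Latin squares. Only row and column sums matter here, not diagonals.\<close>

definition magic_square :: "nat \<Rightarrow> nat \<Rightarrow> nat \<Rightarrow> nat" where
  "magic_square m i j = m * ((i + j) mod m) + (2 * i + j) mod m"

lemma div_mod_unique_nat:
  fixes a b c d n :: nat
  assumes "n * a + b = n * c + d" "b < n" "d < n"
  shows "a = c" "b = d"
proof -
  have "(n * a + b) div n = a" "(n * c + d) div n = c"
    using assms(2,3) by auto
  then show "a = c" using assms(1) by metis
  then show "b = d" using assms(1) by simp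
qed

lemma magic_square_less:
  assumes "m > 0"
  shows "magic_square m i j < m * m"
proof -
  have "magic_square m i j < m * ((i + j) mod m) + m"
    using assms by (simp add: magic_square_def)
  also have "\<dots> = m * Suc ((i + j) mod m)" by simp
  also have "\<dots> \<le> m * m"
    using assms by (intro mult_le_mono) (auto simp: Suc_le_eq)
  finally show ?thesis .
qed

lemma magic_square_inject:
  assumes "magic_square m i j = magic_square m i' j'" "i < m" "j < m" "i' < m" "j' < m"
  shows "i = i' \<and> j = j'"
proof -
  have "m > 0" using assms by simp
  have 1: "[i + j = i' + j'] (mod m)" and 2: "[2 * i + j = 2 * i' + j'] (mod m)"
    using div_mod_unique_nat[OF assms(1)[unfolded magic_square_def]] \<open>m > 0\<close>
    by (auto simp: cong_def)
  \<comment> \<open>The difference of the two congruences isolates \<open>i\<close>; on naturals it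
    is obtained by cancelling a common summand.\<close>
  have "[i + (i + j) = i' + (i' + j')] (mod m)"
    using 2 by (simp only: mult_2 add.assoc)
  moreover have "[i' + (i + j) = i' + (i' + j')] (mod m)"
    using 1 by (simp only: cong_add_lcancel_nat)
  ultimately have "[i + (i + j) = i' + (i + j)] (mod m)"
    by (metis cong_trans cong_sym)
  then have "i = i'"
    using assms by (simp add: cong_add_rcancel_nat) (simp add: cong_def)
  with 1 have "j = j'"
    using assms by (simp add: cong_add_lcancel_nat) (simp add: cong_def)
  with \<open>i = i'\<close> show ?thesis by simp
qed

section \<open>Permutations with nearly constant sum\<close>

text \<open>The first three permutations of \<open>{..<s}\<close> form a Kotzig array if \<open>s\<close> is odd and nearly so if
  \<open>s\<close> is even; the others are complementary pairs.\<close>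

definition kotzig :: "nat \<Rightarrow> nat \<Rightarrow> nat \<Rightarrow> nat" where
  "kotzig s a q =
    (if a = 1 then if q < s - s div 2 then q + s div 2 else q - (s - s div 2)
     else if a = 2 then if q < s - s div 2 then s - 1 - 2 * q else 2 * s + s mod 2 - 2 - 2 * q
     else if a = 0 \<or> odd a then q else s - 1 - q)"

lemma kotzig_simps:
  "kotzig s 0 q = q"
  "kotzig s 1 q = (if q < s - s div 2 then q + s div 2 else q - (s - s div 2))"
  "kotzig s 2 q = (if q < s - s div 2 then s - 1 - 2 * q else 2 * s + s mod 2 - 2 - 2 * q)"
  by (simp_all add: kotzig_def)

text \<open>Replaces \<open>div\<close> and \<open>mod\<close> by linear terms, so that arithmetic
  can treat both parities of \<open>s\<close>.\<close>

lemma nat_halves: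
  obtains n e :: nat where "s = 2 * n + e" "e \<le> 1" "s div 2 = n" "s mod 2 = e"
proof
  show "s = 2 * (s div 2) + s mod 2" "s mod 2 \<le> 1" by simp_all
qed (rule refl)+

lemma kotzig_less:
  assumes "q < s"
  shows "kotzig s a q < s"
proof -
  obtain n e :: nat where *: "s = 2 * n + e" "e \<le> 1" "s div 2 = n" "s mod 2 = e"
    by (rule nat_halves)
  show ?thesis
    using assms *(1,2) unfolding kotzig_def *(3,4) by (simp split: if_split) linarith
qed

lemma kotzig_inject:
  assumes "q < s" "q' < s" "kotzig s a q = kotzig s a q'"
  shows "q = q'"
proof (cases "a = 2")
  case True
  obtain n e :: nat where *: "s = 2 * n + e" "e \<le> 1" "s div 2 = n" "s mod 2 = e"
    by (rule nat_halves)
  \<comment> \<open>For \<open>a = 2\<close> the two branches take values of opposite parity, so a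
    collision between them is contradictory.\<close>
  have diff: "q = q'" if "q < s" "q' < s" "q < n + e" "\<not> q' < n + e"
      "2 * n + e - 1 - 2 * q = 4 * n + 3 * e - 2 - 2 * q'" for q q' :: nat
  proof -
    have "2 * q' + 1 = 2 * (n + e + q)"
      using that *(1,2) by (cases "e = 0") auto
    then show ?thesis by presburger
  qed
  have 2: "kotzig s 2 q = (if q < n + e then 2 * n + e - 1 - 2 * q else 4 * n + 3 * e - 2 - 2 * q)"
    for q using *(1) unfolding kotzig_simps *(3,4) by (simp add: add.commute)
  show ?thesis
  proof (cases "q < n + e \<longleftrightarrow> q' < n + e")
    case True
    then show ?thesis
      using assms *(1,2) unfolding \<open>a = 2\<close> 2 by (cases "e = 0") (auto split: if_splits)
  next
    case False
    then show ?thesis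
      using assms(3) diff[OF assms(1,2)] diff[OF assms(2,1)] unfolding \<open>a = 2\<close> 2
      by (simp split: if_splits)
  qed
next
  case False
  then show ?thesis using assms unfolding kotzig_def by (simp split: if_splits)
qed

text \<open>Each complementary pair contributes \<open>s - 1\<close>. The first three permutations
  give \<open>s div 2 + s - 1\<close>, less 1 exactly when \<open>s\<close> is even and
  \<open>q\<close> lies in the second branch.\<close>

lemma sum_kotzig:
  assumes "q < s"
  shows "\<exists>e\<le>1. (\<Sum>a<2 * h + 3. kotzig s a q) + e = s div 2 + s - 1 + h * (s - 1)"
proof -
  have "\<exists>e\<le>1. (\<Sum>a<3. kotzig s a q) + e = s div 2 + s - 1"
  proof -
    obtain n e :: nat where *: "s = 2 * n + e" "e \<le> 1" "s div 2 = n" "s mod 2 = e"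
        by (rule nat_halves)
    have "{..<3 :: nat} = {0, 1, 2}" by auto
    then have sum: "(\<Sum>a<3. kotzig s a q) = kotzig s 0 q + kotzig s 1 q + kotzig s 2 q"
      by simp
    show ?thesis
    proof (cases "q < n + e")
      case True
      then have "(\<Sum>a<3. kotzig s a q) = n + s - 1"
        using *(1,2) unfolding sum kotzig_simps *(3,4) by (cases "e = 0") auto
      then show ?thesis using * by (intro exI[of _ 0]) simp
    next
      case False
      then have "(\<Sum>a<3. kotzig s a q) + (1 - e) = n + s - 1"
        using assms *(1,2) unfolding sum kotzig_simps *(3,4) by (cases "e = 0") auto
      then show ?thesis using * by (intro exI[of _ "1 - e"]) simp
    qed
  qed
  moreover have "(\<Sum>a<2 * h + 3. kotzig s a q) = (\<Sum>a<3. kotzig s a q) + h * (s - 1)"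
  proof (induction h)
    case (Suc h)
    have "kotzig s (2 * h + 3) q = q" "kotzig s (Suc (2 * h + 3)) q = s - 1 - q"
      by (auto simp: kotzig_def)
    moreover have "2 * Suc h + 3 = Suc (Suc (2 * h + 3))" by simp
    ultimately show ?case
      using Suc assms by (simp only: sum.lessThan_Suc) simp
  qed simp
  ultimately show ?thesis by auto
qed

section \<open>The bit matrix\<close>

text \<open>For \<open>h \<ge> 1\<close>: a lower left block of ones with \<open>h - 1\<close> rows
  and \<open>h\<close> columns, and an upper right block of ones with \<open>h + 2\<close> rows and
  \<open>h + 1\<close> columns, from which each row loses one entry. The holes run down a diagonal,
  the last three all in column \<open>2 * h - 1\<close>; column \<open>2 * h\<close> has
  none.\<close>

definition bits :: "nat \<Rightarrow> nat \<Rightarrow> nat \<Rightarrow> bool" where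
  "bits h i j = (if j < h then h + 2 \<le> i else i < h + 2 \<and> j \<noteq> h + min i (h - 1))"

lemma card_bits_row:
  assumes "h \<ge> 1"
  shows "card {j. j < 2 * h + 1 \<and> bits h i j} = h"
proof (cases "i < h + 2")
  case True
  then have "{j. j < 2 * h + 1 \<and> bits h i j} = {h..<2 * h + 1} - {h + min i (h - 1)}"
    by (auto simp: bits_def)
  with assms show ?thesis by (simp add: card_Diff_singleton)
next
  case False
  then have "{j. j < 2 * h + 1 \<and> bits h i j} = {..<h}"
    by (auto simp: bits_def)
  then show ?thesis by simp
qed

lemma card_bits_column:
  assumes "h \<ge> 1" "j < 2 * h + 1"
  shows "card {i. i < 2 * h + 1 \<and> bits h i j} \<in> {h - 1, h + 1, h + 2}"
proof -
  consider "j < h" | "h \<le> j" "j < 2 * h - 1" | "j = 2 * h - 1" "h \<le> j" | "j = 2 * h"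
    using assms by linarith
  then show ?thesis
  proof cases
    case 1
    then have "{i. i < 2 * h + 1 \<and> bits h i j} = {h + 2..<2 * h + 1}"
      by (auto simp: bits_def)
    then show ?thesis by simp
  next
    case 2
    then have "{i. i < 2 * h + 1 \<and> bits h i j} = {..<h + 2} - {j - h}"
      using assms by (auto simp: bits_def min_def split: if_splits)
    with 2 show ?thesis by (simp add: card_Diff_singleton)
  next
    case 3
    then have "{i. i < 2 * h + 1 \<and> bits h i j} = {..<h - 1}"
      using assms by (auto simp: bits_def min_def split: if_splits)
    then show ?thesis by simp
  next
    case 4
    then have "{i. i < 2 * h + 1 \<and> bits h i j} = {..<h + 2}"
      using assms by (auto simp: bits_def min_def split: if_splits)
    then show ?thesis by simp
  qed
qed

lemma sum_of_bool_eq_card: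
  "(\<Sum>i<n. of_bool (P i)) = card {i. i < n \<and> P i}" for n :: nat
proof -
  have "{..<n} \<inter> Collect P = {i. i < n \<and> P i}" by auto
  then show ?thesis by simp
qed

lemma sum_of_bool_xor:
  fixes n :: nat
  shows "(\<Sum>i<n. of_bool (P i \<noteq> Q))
    = (if Q then n - card {i. i < n \<and> P i} else card {i. i < n \<and> P i})"
proof -
  have "card {i. i < n \<and> \<not> P i} = card ({..<n} - {i. i < n \<and> P i})"
    by (rule arg_cong[of _ _ card]) auto
  also have "\<dots> = n - card {i. i < n \<and> P i}"
    by (subst card_Diff_subset) auto
  finally show ?thesis
    by (simp only: sum_of_bool_eq_card) simp
qed

section \<open>The labeling\<close>

text \<open>The permutation index is the high digit of the magic square, so each line meets every
  permutation exactly once. Copies \<open>2 * q\<close> and \<open>2 * q + 1\<close> share the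
  argument \<open>q\<close> and have complementary bits.\<close>

definition label :: "nat \<Rightarrow> nat \<Rightarrow> nat \<times> nat \<times> nat \<Rightarrow> nat" where
  "label h s = (\<lambda>(k, i, j). let m = 2 * h + 1 in
     1 + (2 * (s * magic_square m i j + kotzig s ((i + j) mod m) (k div 2))
          + of_bool (bits h i j \<noteq> odd k)))"

text \<open>Mixed radix decoding: after the bit, the quotient by \<open>s\<close> yields the cell.
  The cell fixes the permutation, so the remainder yields \<open>k div 2\<close>, and the bit yields
  the parity of \<open>k\<close>. Surjectivity follows by counting.\<close>

lemma bij_betw_label:
  assumes m: "m = 2 * h + 1"
  shows "bij_betw (label h s) ({..<2 * s} \<times> {..<m} \<times> {..<m}) {1..2 * s * (m * m)}"
proof -
  let ?D = "{..<2 * s} \<times> {..<m} \<times> {..<m}"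
  have "m > 0" by (simp add: m)
  have inj: "inj_on (label h s) ?D"
  proof (rule inj_onI, clarsimp)
    fix k i j k' i' j'
    assume b: "k < 2 * s" "i < m" "j < m" "k' < 2 * s" "i' < m" "j' < m"
      and "label h s (k, i, j) = label h s (k', i', j')"
    then have eq: "2 * (s * magic_square m i j + kotzig s ((i + j) mod m) (k div 2))
          + of_bool (bits h i j \<noteq> odd k)
        = 2 * (s * magic_square m i' j' + kotzig s ((i' + j') mod m) (k' div 2))
          + of_bool (bits h i' j' \<noteq> odd k')"
      by (simp add: label_def Let_def m del: of_bool_eq_iff)
    have q: "k div 2 < s" "k' div 2 < s"
      using b by auto
    note * = div_mod_unique_nat[OF eq]
    have 1: "s * magic_square m i j + kotzig s ((i + j) mod m) (k div 2)
        = s * magic_square m i' j' + kotzig s ((i' + j') mod m) (k' div 2)"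
      by (rule *) auto
    have 2: "(of_bool (bits h i j \<noteq> odd k) :: nat) = of_bool (bits h i' j' \<noteq> odd k')"
      by (rule *) auto
    note ** = div_mod_unique_nat[OF 1 kotzig_less[OF q(1)] kotzig_less[OF q(2)]]
    from magic_square_inject[OF **(1)] b have ij: "i = i'" "j = j'"
      by auto
    with **(2) kotzig_inject q have "k div 2 = k' div 2"
      by metis
    moreover have "odd k \<longleftrightarrow> odd k'"
      using 2 ij by (simp only: of_bool_eq_iff) blast
    ultimately have "k = k'"
      by presburger
    with ij show "k = k' \<and> i = i' \<and> j = j'" by simp
  qed
  have "label h s ` ?D \<subseteq> {1..2 * s * (m * m)}"
  proof clarify
    fix k i j assume "k < 2 * s"
    then have "kotzig s ((i + j) mod m) (k div 2) < s"
      by (intro kotzig_less) auto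
    moreover have "s * Suc (magic_square m i j) \<le> s * (m * m)"
      using magic_square_less[OF \<open>m > 0\<close>] by (intro mult_le_mono) (auto simp: Suc_le_eq)
    ultimately have less: "s * magic_square m i j + kotzig s ((i + j) mod m) (k div 2) < s * (m * m)"
      by simp
    have "1 + (2 * x + y) \<le> 2 * t" if "x < t" "y \<le> 1" for x y t :: nat
      using that by simp
    from this[OF less, of "of_bool (bits h i j \<noteq> odd k)"]
    have "label h s (k, i, j) \<le> 2 * (s * (m * m))"
      unfolding label_def Let_def m[symmetric] prod.case by simp
    then show "label h s (k, i, j) \<in> {1..2 * s * (m * m)}"
      by (simp add: label_def Let_def)
  qed
  moreover have "card (label h s ` ?D) = card {1..2 * s * (m * m)}"
    using inj by (simp add: card_image)
  ultimately show ?thesis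
    unfolding bij_betw_def using inj card_subset_eq by blast
qed

lemma sum_label_row:
  assumes m: "m = 2 * h + 1"
  shows "(\<Sum>j<m. label h s (k, i, j))
    = m + 2 * (s * (m * \<Sum>{..<m} + \<Sum>{..<m}) + (\<Sum>a<m. kotzig s a (k div 2)))
      + (\<Sum>j<m. of_bool (bits h i j \<noteq> odd k))"
proof -
  have "(\<Sum>j<m. g ((x + j) mod m)) = (\<Sum>a<m. g a)" for x and g :: "nat \<Rightarrow> nat"
    using sum_affine_mod[of 1 m g x] by (simp add: m)
  note aff = this[of "\<lambda>a. a" i] this[of "\<lambda>a. a" "2 * i"]
    this[of "\<lambda>a. kotzig s a (k div 2)" i]
  show ?thesis
    unfolding label_def Let_def prod.case m[symmetric] magic_square_def
    by (simp only: sum.distrib sum_distrib_left[symmetric] aff) simp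
qed

lemma sum_label_column:
  assumes m: "m = 2 * h + 1"
  shows "(\<Sum>i<m. label h s (k, i, j))
    = m + 2 * (s * (m * \<Sum>{..<m} + \<Sum>{..<m}) + (\<Sum>a<m. kotzig s a (k div 2)))
      + (\<Sum>i<m. of_bool (bits h i j \<noteq> odd k))"
proof -
  have "(\<Sum>i<m. g ((i + j) mod m)) = (\<Sum>a<m. g a)" for g :: "nat \<Rightarrow> nat"
    using sum_affine_mod[of 1 m g j] by (simp add: m add.commute)
  note aff = this[of "\<lambda>a. a"] this[of "\<lambda>a. kotzig s a (k div 2)"]
  \<comment> \<open>Down a column the low digit advances by 2, which is a unit because
    \<open>m\<close> is odd.\<close>
  have double: "(\<Sum>i<m. (2 * i + j) mod m) = \<Sum>{..<m}"
    using sum_affine_mod[of 2 m "\<lambda>a. a" j] by (simp add: m add.commute)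
  show ?thesis
    unfolding label_def Let_def prod.case m[symmetric] magic_square_def
    by (simp only: sum.distrib sum_distrib_left[symmetric] aff double) simp
qed

lemma chi_la_copies_le_6:
  assumes "h \<ge> 1" and m: "m = 2 * h + 1"
  shows "chi_la (copies (2 * s) (complete_bipartite m m)) \<le> 6"
proof -
  define row col where "row k i = (\<Sum>j<m. of_bool (bits h i j \<noteq> odd k) :: nat)"
    and "col k j = (\<Sum>i<m. of_bool (bits h i j \<noteq> odd k) :: nat)" for k i j :: nat
  have row: "row k i = (if odd k then h + 1 else h)" for k i
    unfolding row_def sum_of_bool_xor m card_bits_row[OF assms(1)] by simp
  have col: "row k i \<noteq> col k j" "h - 1 \<le> col k j" "col k j \<le> h + 2"
    if "j < m" for k i j
  proof -
    define c where "c = card {i. i < m \<and> bits h i j}"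
    have c: "c = h - 1 \<or> c = h + 1 \<or> c = h + 2"
      using card_bits_column[OF \<open>h \<ge> 1\<close>, of j] that unfolding c_def m by blast
    have "col k j = (if odd k then m - c else c)"
      unfolding col_def c_def by (rule sum_of_bool_xor)
    \<comment> \<open>Complementing turns the column values \<open>h - 1\<close>,
      \<open>h + 1\<close>, \<open>h + 2\<close> into \<open>h + 2\<close>, \<open>h\<close>,
      \<open>h - 1\<close>, which avoid the new row value \<open>h + 1\<close>.\<close>
    then have "col k j = m - c \<and> row k i = h + 1 \<or> col k j = c \<and> row k i = h"
      by (simp add: row)
    with c m \<open>h \<ge> 1\<close> show "row k i \<noteq> col k j" "h - 1 \<le> col k j" "col k j \<le> h + 2"
      by linarith+
  qed
  define U where "U = s div 2 + s - 1 + (h - 1) * (s - 1)"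
  define base where "base k = m + 2 * (s * (m * \<Sum>{..<m} + \<Sum>{..<m}) + (\<Sum>a<m. kotzig s a (k div 2)))"
    for k
  define W where "W = m + 2 * (s * (m * \<Sum>{..<m} + \<Sum>{..<m}) + U)"
  \<comment> \<open>Keeps the subtraction in \<open>W + h - 3\<close> from being truncated.\<close>
  have "W \<ge> 3" using assms by (simp add: W_def)
  have interval: "base k + t \<in> {W + h - 3..W + h + 2}"
    if k: "k < 2 * s" and t: "h - 1 \<le> t" "t \<le> h + 2" for k t
  proof -
    have m': "m = 2 * (h - 1) + 3" using assms by simp
    have "k div 2 < s" using k by auto
    then obtain e where "e \<le> 1" "(\<Sum>a<m. kotzig s a (k div 2)) + e = U"
      using sum_kotzig unfolding U_def m' by blast
    \<comment> \<open>The deficit \<open>e\<close> of the permutation sum counts twice, so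
      \<open>base k\<close> is \<open>W\<close> or \<open>W - 2\<close>.\<close>
    then have "base k + 2 * e = W"
      unfolding W_def base_def by simp
    with \<open>e \<le> 1\<close> t \<open>W \<ge> 3\<close> \<open>h \<ge> 1\<close> show ?thesis
      unfolding atLeastAtMost_iff by linarith
  qed
  have "chi_la (copies (2 * s) (complete_bipartite m m)) \<le> enat (card {W + h - 3..W + h + 2})"
  proof (rule chi_la_copies_le[OF bij_betw_label[OF m, of s]],
      unfold sum_label_row[OF m] sum_label_column[OF m], fold row_def col_def base_def)
    fix k i j assume "j < m"
    then have "row k i \<noteq> col k j" by (rule col)
    then show "base k + row k i \<noteq> base k + col k j" by simp
  next
    fix k i assume "k < 2 * s"
    then show "base k + row k i \<in> {W + h - 3..W + h + 2}"
      by (rule interval) (use row[of k i] in \<open>simp_all split: if_splits\<close>)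
  next
    fix k j assume "k < 2 * s" "j < m"
    show "base k + col k j \<in> {W + h - 3..W + h + 2}"
      by (rule interval[OF \<open>k < 2 * s\<close>])
         (rule col[OF \<open>j < m\<close>])+
  qed simp
  also have "card {W + h - 3..W + h + 2} = 6"
    using \<open>W \<ge> 3\<close> by simp
  finally show ?thesis
    by (simp add: numeral_eq_enat)
qed

theorem theorem2p5:
  fixes m r :: nat
  assumes "m \<ge> 3" and "odd m" and "r \<ge> 2" and "even r"
  shows "3 \<le> chi_la (copies r (complete_bipartite m m)) \<and>
         chi_la (copies r (complete_bipartite m m)) \<le> 6"
proof
  show "3 \<le> chi_la (copies r (complete_bipartite m m))"
    using assms by (intro chi_la_copies_ge_3) auto
  from \<open>odd m\<close> obtain h where "m = 2 * h + 1" by (rule oddE)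
  moreover from \<open>even r\<close> obtain s where "r = 2 * s" by (rule evenE)
  ultimately show "chi_la (copies r (complete_bipartite m m)) \<le> 6"
    using chi_la_copies_le_6[of h m s] \<open>m \<ge> 3\<close> by simp
qed

end
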